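(* If $\Omega$ is a bounded open convex set in $\mathbb{R}^N$, then $$\frac{1}{R_F(\Omega)}\le h_F(\Omega).$$ Moreover, the inequality is optimal for a suitable sequence of $N$-rectangular domains: there is a sequence $(\Omega_k)_k$ of $N$-dimensional open rectangles (products of bounded open intervals with respect to some orthonormal coordinate system of $\mathbb{R}^N$) such that $R_F(\Omega_k)\,h_F(\Omega_k)\to1$ as $k\to+\infty$.
   Context: Let $N\ge2$, $1<p<+\infty$, and let $F:\mathbb{R}^N\to[0,+\infty)$ be a convex function with $F(t\xi)=|t|F(\xi)$ for all $t\in\mathbb R$, $\xi\in\mathbb{R}^N$, with $a|\xi|\le F(\xi)$ for some constant $a>0$, with $F\in C^{3,\beta}(\mathbb{R}^N\setminus\{0\})$, and such that the Hessian $[F^p]_{\xi\xi}(\xi)$ is positive definite for every $\xi\neq0$. The polar function is $F^o(v)=\sup_{\xi\ne0}\frac{\langle\xi,v\rangle}{F(\xi)}$. Anisotropic inradius: $d_F(x)=\inf_{y\in\partial\Omega}F^o(x-y)$ for $x\in\overline\Omega$, and $R_F(\Omega)=\sup_{x\in\Omega}d_F(x)$. Anisotropic perimeter: $P_F(K)=\sup\left\{\int_K\operatorname{div}\sigma\,dx:\ \sigma\in C_0^1(\mathbb{R}^N;\mathbb{R}^N),\ F^o(\sigma)\le1\right\}$. Anisotropic Cheeger constant: $h_F(\Omega)=\inf_{K\subset\Omega}\frac{P_F(K)}{|K|}$ (over measurable $K$ with $|K|>0$). *)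

theory Defs
  imports "HOL-Analysis.Analysis"
begin

definition partial_deriv ::
    "'n \<Rightarrow> (real^'n \<Rightarrow> 'b::real_normed_vector) \<Rightarrow> real^'n \<Rightarrow> 'b" where
  "partial_deriv i f x = frechet_derivative f (at x) (axis i 1)"

text \<open>Hoelder continuity on open sets is meant locally, i.e. uniformly on compact subsets.
  On the punctured space a global bound is impossible for the derivatives of a
  1-homogeneous function, since its third derivatives are homogeneous of degree -2.\<close>

definition locally_hoelder_on :: "real \<Rightarrow> (real^'n) set \<Rightarrow> (real^'n \<Rightarrow> real) \<Rightarrow> bool" where
  "locally_hoelder_on \<beta> S f \<longleftrightarrow>
     (\<forall>K. compact K \<and> K \<subseteq> S \<longrightarrow>
        (\<exists>C. \<forall>x\<in>K. \<forall>y\<in>K. \<bar>f x - f y\<bar> \<le> C * norm (x - y) powr \<beta>))"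

primrec C_hoelder_on :: "nat \<Rightarrow> real \<Rightarrow> (real^'n) set \<Rightarrow> (real^'n \<Rightarrow> real) \<Rightarrow> bool" where
  "C_hoelder_on 0 \<beta> S f \<longleftrightarrow> locally_hoelder_on \<beta> S f"
| "C_hoelder_on (Suc k) \<beta> S f \<longleftrightarrow>
     (\<forall>x\<in>S. f differentiable (at x)) \<and> (\<forall>i. C_hoelder_on k \<beta> S (partial_deriv i f))"

definition hessian :: "(real^'n \<Rightarrow> real) \<Rightarrow> real^'n \<Rightarrow> real^'n^'n" where
  "hessian f x = (\<chi> i j. partial_deriv i (partial_deriv j f) x)"

definition positive_definite :: "real^'n^'n \<Rightarrow> bool" where
  "positive_definite A \<longleftrightarrow> transpose A = A \<and> (\<forall>v. v \<noteq> 0 \<longrightarrow> 0 < v \<bullet> (A *v v))"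

definition polar_fun :: "(real^'n \<Rightarrow> real) \<Rightarrow> real^'n \<Rightarrow> real" where
  "polar_fun F v = (SUP \<xi>\<in>-{0}. (\<xi> \<bullet> v) / F \<xi>)"

text \<open>The quantities below take values in the extended reals, because the perimeter of a
  measurable set may be infinite.\<close>

definition anisotropic_dist :: "(real^'n \<Rightarrow> real) \<Rightarrow> (real^'n) set \<Rightarrow> real^'n \<Rightarrow> ereal" where
  "anisotropic_dist F \<Omega> x = (INF y\<in>frontier \<Omega>. ereal (polar_fun F (x - y)))"

definition anisotropic_inradius :: "(real^'n \<Rightarrow> real) \<Rightarrow> (real^'n) set \<Rightarrow> ereal" where
  "anisotropic_inradius F \<Omega> = (SUP x\<in>\<Omega>. anisotropic_dist F \<Omega> x)"

definition divergence :: "(real^'n \<Rightarrow> real^'n) \<Rightarrow> real^'n \<Rightarrow> real" where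
  "divergence \<sigma> x = (\<Sum>i\<in>UNIV. partial_deriv i \<sigma> x $ i)"

definition C1_compact_support :: "(real^'n \<Rightarrow> real^'n) set" where
  "C1_compact_support =
     {\<sigma>. (\<forall>x. \<sigma> differentiable (at x)) \<and>
          (\<forall>i. continuous_on UNIV (partial_deriv i \<sigma>)) \<and>
          compact (closure {x. \<sigma> x \<noteq> 0})}"

definition anisotropic_perimeter :: "(real^'n \<Rightarrow> real) \<Rightarrow> (real^'n) set \<Rightarrow> ereal" where
  "anisotropic_perimeter F K =
     (SUP \<sigma>\<in>{\<sigma> \<in> C1_compact_support. \<forall>x. polar_fun F (\<sigma> x) \<le> 1}.
        ereal (LINT x:K|lebesgue. divergence \<sigma> x))"

definition anisotropic_cheeger :: "(real^'n \<Rightarrow> real) \<Rightarrow> (real^'n) set \<Rightarrow> ereal" where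
  "anisotropic_cheeger F \<Omega> =
     (INF K\<in>{K \<in> sets lebesgue. K \<subseteq> \<Omega> \<and> 0 < emeasure lebesgue K}.
        anisotropic_perimeter F K / enn2ereal (emeasure lebesgue K))"

definition open_rectangle :: "(real^'n) set \<Rightarrow> bool" where
  "open_rectangle R \<longleftrightarrow>
     (\<exists>(T :: real^'n \<Rightarrow> real^'n) a b. orthogonal_transformation T \<and> (\<forall>i. a $ i < b $ i) \<and> R = T ` box a b)"

end

theory Submission
  imports Defs
begin

text \<open>Lower bound: for \<open>r\<close> above the inradius, finitely many supporting half spaces
  \<open>n\<^sub>i \<bullet> x \<le> c\<^sub>i\<close> of \<open>\<Omega>\<close>, normalised by \<open>F n\<^sub>i = 1\<close>, suffice for every point of \<open>\<Omega>\<close> to have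
  anisotropic distance less than \<open>r\<close> to one of them. Let \<open>z\<^sub>i\<close> be a subgradient of \<open>F\<close> at \<open>n\<^sub>i\<close>, put
  \<open>s\<^sub>i x = n\<^sub>i \<bullet> x - c\<^sub>i\<close>, let \<open>p\<^sub>i\<close> be the softmax weights of \<open>\<kappa> s\<^sub>i\<close> and let \<open>\<beta>\<close> be a ramp from \<open>0\<close> to
  \<open>1\<close> with slope about \<open>1/r\<close> on \<open>[-r, 0]\<close>. The field \<open>\<sigma> = (\<Sum>i. p\<^sub>i \<beta>(s\<^sub>i) z\<^sub>i)\<close> lies in the polar unit ball,
  being a subconvex combination of the \<open>z\<^sub>i\<close>, and its divergence is
  \<open>(\<Sum>i. p\<^sub>i \<beta>'(s\<^sub>i)) + \<kappa> (\<Sum>i. p\<^sub>i \<beta>(s\<^sub>i) (1 - (\<Sum>j. p\<^sub>j (n\<^sub>j \<bullet> z\<^sub>i))))\<close>. The second sum is nonnegative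
  because \<open>n\<^sub>j \<bullet> z\<^sub>i \<le> F n\<^sub>j = 1\<close>, and the first is about \<open>1/r\<close> for large \<open>\<kappa>\<close>, because the weight then sits
  on the nearest half spaces.

  Optimality: a box of width \<open>2\<close> in one coordinate and width \<open>2(k+1)\<close> in the others has inradius at most
  \<open>1 / F e\<close>, where \<open>e\<close> is the unit vector of the short side, and choosing \<open>K\<close> to be the box itself shows
  that its Cheeger constant is at most \<open>F e + O(1/k)\<close>.\<close>

section \<open>One-variable calculus: a continuously differentiable ramp\<close>

lemma has_real_derivative_max_0_power2:
  "((\<lambda>s::real. (max 0 s)\<^sup>2) has_real_derivative 2 * max 0 s) (at s)"
proof -
  have "((\<lambda>s::real. if s \<in> {0..} then s\<^sup>2 else 0) has_vector_derivative
      (if s \<in> {0..} then 2 * s else 0)) (at s within UNIV)"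
    by (rule has_vector_derivative_If_within_closures[where T = "{..0}" and f' = "\<lambda>s. 2 * s" and g' = "\<lambda>_. 0"])
      (auto intro!: derivative_eq_intros simp: has_real_derivative_iff_has_vector_derivative[symmetric])
  moreover have "(\<lambda>s::real. if s \<in> {0..} then s\<^sup>2 else 0) = (\<lambda>s. (max 0 s)\<^sup>2)"
    by (auto simp: fun_eq_iff max_def)
  moreover have "(if s \<in> {0..} then 2 * s else 0) = 2 * max 0 s"
    by auto
  ultimately show ?thesis
    by (simp add: has_real_derivative_iff_has_vector_derivative)
qed

text \<open>Up to the factor \<open>1 / (L * \<delta>)\<close>, \<open>\<beta>'\<close> is a
  unit-slope ramp of height \<open>\<delta>\<close> minus its translate by \<open>L\<close>. Hence
  it is continuous and nonnegative, has integral 1, and equals \<open>1 / L\<close> between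
  \<open>\<delta>\<close> and \<open>L\<close>. \<open>\<beta>\<close> is its antiderivative, built
  from squares of positive parts.\<close>

lemma C1_ramp_exists:
  fixes L \<delta> :: real
  assumes "0 < L" "0 < \<delta>"
  obtains \<beta> \<beta>' :: "real \<Rightarrow> real"
  where "\<And>s. (\<beta> has_real_derivative \<beta>' s) (at s)" "continuous_on UNIV \<beta>'"
    "\<And>s. 0 \<le> \<beta>' s" "\<And>s. 0 \<le> \<beta> s" "\<And>s. \<beta> s \<le> 1" "\<And>s. s \<le> 0 \<Longrightarrow> \<beta> s = 0"
    "\<And>s. s \<le> 0 \<Longrightarrow> \<beta>' s = 0" "\<And>s. L + \<delta> \<le> s \<Longrightarrow> \<beta> s = 1"
    "\<And>s. \<delta> \<le> s \<Longrightarrow> s \<le> L \<Longrightarrow> \<beta>' s = 1 / L"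
proof -
  define q where "q s = (max 0 s)\<^sup>2" for s :: real
  have q: "((\<lambda>s. q (s - c)) has_real_derivative 2 * max 0 (s - c)) (at s)" for c s
    unfolding q_def using has_real_derivative_max_0_power2[of "s - c"]
    by (rule DERIV_chain2[where g = "\<lambda>s. s - c" and Db = 1, simplified]) (auto intro!: derivative_eq_intros)
  define \<beta> where "\<beta> s = (q s - q (s - \<delta>) - q (s - L) + q (s - (L + \<delta>))) / (2 * L * \<delta>)" for s
  define \<beta>' where "\<beta>' s = (max 0 s - max 0 (s - \<delta>) - max 0 (s - L) + max 0 (s - (L + \<delta>))) / (L * \<delta>)" for s
  have q0: "(q has_real_derivative 2 * max 0 s) (at s)" for s
    using q[of 0 s] by simp
  have D: "(\<beta> has_real_derivative \<beta>' s) (at s)" for s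
    unfolding \<beta>_def \<beta>'_def using assms
    by (auto intro!: derivative_eq_intros q0 q[of _ s] simp: field_simps)
  have pos: "0 \<le> \<beta>' s" for s
    unfolding \<beta>'_def using assms by (intro divide_nonneg_pos) (auto simp: max_def)
  have mono: "\<beta> s \<le> \<beta> t" if "s \<le> t" for s t
    using DERIV_nonneg_imp_nondecreasing[OF that] D pos by blast
  have zero: "\<beta> s = 0" if "s \<le> 0" for s
    unfolding \<beta>_def q_def using that assms by (simp add: max_def)
  have one: "\<beta> s = 1" if "L + \<delta> \<le> s" for s
  proof -
    have "\<beta> s = (s\<^sup>2 - (s - \<delta>)\<^sup>2 - (s - L)\<^sup>2 + (s - (L + \<delta>))\<^sup>2) / (2 * L * \<delta>)"
      unfolding \<beta>_def q_def using that assms by (simp add: max_def)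
    also have "\<dots> = 1"
      using assms by (simp add: field_simps power2_eq_square)
    finally show ?thesis .
  qed
  show thesis
  proof (rule that[OF D _ pos _ _ zero _ one])
    show "continuous_on UNIV \<beta>'"
      unfolding \<beta>'_def using assms by (intro continuous_intros) auto
    show "0 \<le> \<beta> s" for s
      using mono[of "min s 0" s] zero[of "min s 0"] by simp
    show "\<beta> s \<le> 1" for s
      using mono[of s "max s (L + \<delta>)"] one[of "max s (L + \<delta>)"] by simp
    show "\<beta>' s = 0" if "s \<le> 0" for s
      unfolding \<beta>'_def using that assms by (simp add: max_def)
    show "\<beta>' s = 1 / L" if "\<delta> \<le> s" "s \<le> L" for s
      unfolding \<beta>'_def using that assms by (simp add: max_def)
  qed
qed

section \<open>Divergence and integration over boxes\<close>

lemma partial_deriv_has_derivative: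
  "(f has_derivative D) (at x) \<Longrightarrow> partial_deriv i f x = D (axis i 1)"
  unfolding partial_deriv_def by (simp add: frechet_derivative_at[symmetric])

lemma linear_sum_axis:
  fixes f :: "real^'n \<Rightarrow> real"
  assumes "linear f"
  shows "(\<Sum>k\<in>UNIV. f (axis k 1) * z $ k) = f z"
proof -
  have "f z = f (\<Sum>k\<in>UNIV. z $ k *\<^sub>R axis k 1)"
    using basis_expansion[of z] by (simp add: scalar_mult_eq_scaleR)
  also have "\<dots> = (\<Sum>k\<in>UNIV. f (axis k 1) * z $ k)"
    by (simp add: linear_sum[OF assms] linear_cmul[OF assms] mult.commute)
  finally show ?thesis by simp
qed

text \<open>The directions \<open>z i\<close> are constant, so only the coefficients are
  differentiated; expanding \<open>z i\<close> in coordinates turns the trace into the derivative of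
  \<open>g i\<close> along \<open>z i\<close>.\<close>

lemma divergence_sum_scaleR:
  fixes z :: "'i \<Rightarrow> real^'n"
  assumes "\<And>i. i \<in> I \<Longrightarrow> (g i has_derivative g' i) (at x)"
  shows "divergence (\<lambda>x. \<Sum>i\<in>I. g i x *\<^sub>R z i) x = (\<Sum>i\<in>I. g' i (z i))"
proof -
  have "((\<lambda>x. \<Sum>i\<in>I. g i x *\<^sub>R z i) has_derivative (\<lambda>h. \<Sum>i\<in>I. g' i h *\<^sub>R z i)) (at x)"
    by (intro has_derivative_sum has_derivative_scaleR_left assms)
  then have "divergence (\<lambda>x. \<Sum>i\<in>I. g i x *\<^sub>R z i) x = (\<Sum>k\<in>UNIV. \<Sum>i\<in>I. g' i (axis k 1) * z i $ k)"
    unfolding divergence_def by (simp add: partial_deriv_has_derivative)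
  also have "\<dots> = (\<Sum>i\<in>I. \<Sum>k\<in>UNIV. g' i (axis k 1) * z i $ k)"
    by (rule sum.swap)
  also have "\<dots> = (\<Sum>i\<in>I. g' i (z i))"
    using assms by (intro sum.cong refl linear_sum_axis has_derivative_linear) auto
  finally show ?thesis .
qed

text \<open>Instead of Fubini's theorem, the proof differentiates the integral of \<open>f\<close> over the translates of the
  box in direction \<open>i\<close>: moving by \<open>t\<close> only changes two slabs of thickness \<open>t\<close>.\<close>

lemma integral_partial_deriv_bound:
  fixes f :: "real^'n \<Rightarrow> real"
  assumes D: "\<And>x. (f has_derivative f' x) (at x)"
    and cont: "continuous_on UNIV (\<lambda>x. f' x (axis i 1))"
    and M: "\<And>x. \<bar>f x\<bar> \<le> M" and ab: "\<And>j. a $ j < b $ j"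
  shows "\<bar>integral (cbox a b) (\<lambda>x. f' x (axis i 1))\<bar> \<le> 2 * M * (\<Prod>j\<in>- {i}. b $ j - a $ j)"
proof -
  define e :: "real^'n" where "e = axis i 1"
  define A where "A = (\<Prod>j\<in>- {i}. b $ j - a $ j)"
  define g where "g t = integral (cbox a b) (\<lambda>x. f (x + t *\<^sub>R e))" for t :: real
  have contf: "continuous_on S f" for S
    using D by (meson continuous_at_imp_continuous_on has_derivative_continuous)
  have contf': "continuous_on S (\<lambda>x. f (x + t *\<^sub>R e))" for S t
    by (rule continuous_on_compose2[OF contf[of UNIV]]) (auto intro!: continuous_intros)
  have intf: "f integrable_on cbox u v" for u v
    by (rule integrable_continuous[OF contf])
  have M0: "0 \<le> M" using M[of 0] by linarith
  have slab: "\<bar>integral (cbox u v) f\<bar> \<le> M * (t * A)"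
    if "0 < t" "v $ i - u $ i = t" "\<And>j. j \<noteq> i \<Longrightarrow> v $ j - u $ j = b $ j - a $ j" for u v t
  proof -
    have "norm (integral (cbox u v) f) \<le> M * measure lborel (cbox u v)"
      using M M0 intf by (intro has_integral_bound[OF _ integrable_integral]) auto
    also have "cbox u v \<noteq> {}"
      using that ab by (auto simp: interval_ne_empty_cart) (metis diff_ge_0_iff_ge less_eq_real_def)
    then have "measure lborel (cbox u v) = (\<Prod>j\<in>UNIV. v $ j - u $ j)"
      by (rule content_cbox_cart)
    also have "\<dots> = t * A"
      using that by (simp add: prod.remove[of UNIV i] A_def Compl_eq_Diff_UNIV)
    finally show ?thesis by simp
  qed
  have diff: "\<bar>g t - g 0\<bar> \<le> 2 * M * A * t" if t: "0 < t" "t < b $ i - a $ i" for t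
  proof -
    \<comment> \<open>\<open>cbox c d\<close> is the translated box, \<open>cbox a a'\<close> the
      slab it leaves and \<open>cbox b' d\<close> the slab it enters. As
      \<open>t < b $ i - a $ i\<close>, the old and new boxes share \<open>cbox c b\<close>, which
      cancels in \<open>g t - g 0\<close>.\<close>
    define c where "c = (\<chi> j. if j = i then a $ i + t else a $ j)"
    define d where "d = (\<chi> j. if j = i then b $ i + t else b $ j)"
    define a' where "a' = (\<chi> j. if j = i then a $ i + t else b $ j)"
    define b' where "b' = (\<chi> j. if j = i then b $ i else a $ j)"
    have ie: "x \<bullet> e = x $ i" for x :: "real^'n" by (simp add: e_def inner_axis)
    have ei: "e \<in> Basis" by (simp add: e_def axis_in_Basis_iff)
    have g: "g t = integral (cbox c d) f"
    proof -
      have "c = a + t *\<^sub>R e" "d = b + t *\<^sub>R e"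
        by (auto simp: c_def d_def e_def vec_eq_iff axis_def)
      then show ?thesis
        using integral_shift_cbox[of c "t *\<^sub>R e" d f] by (simp add: g_def)
    qed
    have 1: "integral (cbox a b) f = integral (cbox a a') f + integral (cbox c b) f"
    proof -
      have "integral (cbox a b) f = integral (cbox a b \<inter> {x. x \<bullet> e \<le> a $ i + t}) f
          + integral (cbox a b \<inter> {x. x \<bullet> e \<ge> a $ i + t}) f"
        by (rule integral_split[OF intf ei])
      also have "cbox a b \<inter> {x. x \<bullet> e \<le> a $ i + t} = cbox a a'"
        unfolding ie interval_split_cart[unfolded interval_cbox_cart]
        using t ab by (intro arg_cong2[where f = cbox]) (auto simp: vec_eq_iff a'_def min_def max_def less_imp_le)
      also have "cbox a b \<inter> {x. x \<bullet> e \<ge> a $ i + t} = cbox c b"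
        unfolding ie interval_split_cart[unfolded interval_cbox_cart]
        using t ab by (intro arg_cong2[where f = cbox]) (auto simp: vec_eq_iff c_def min_def max_def less_imp_le)
      finally show ?thesis .
    qed
    have 2: "integral (cbox c d) f = integral (cbox c b) f + integral (cbox b' d) f"
    proof -
      have "integral (cbox c d) f = integral (cbox c d \<inter> {x. x \<bullet> e \<le> b $ i}) f
          + integral (cbox c d \<inter> {x. x \<bullet> e \<ge> b $ i}) f"
        by (rule integral_split[OF intf ei])
      also have "cbox c d \<inter> {x. x \<bullet> e \<le> b $ i} = cbox c b"
        unfolding ie interval_split_cart[unfolded interval_cbox_cart]
        using t ab by (intro arg_cong2[where f = cbox]) (auto simp: vec_eq_iff d_def min_def max_def less_imp_le)
      also have "cbox c d \<inter> {x. x \<bullet> e \<ge> b $ i} = cbox b' d"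
        unfolding ie interval_split_cart[unfolded interval_cbox_cart]
        using t ab by (intro arg_cong2[where f = cbox]) (auto simp: vec_eq_iff b'_def c_def min_def max_def less_imp_le)
      finally show ?thesis .
    qed
    have "\<bar>integral (cbox a a') f\<bar> \<le> M * (t * A)" "\<bar>integral (cbox b' d) f\<bar> \<le> M * (t * A)"
      using t by (auto intro!: slab simp: a'_def b'_def d_def)
    moreover have "g 0 = integral (cbox a b) f" by (simp add: g_def)
    ultimately show ?thesis
      using 1 2 g by (simp add: algebra_simps)
  qed
  have "(g has_vector_derivative integral (cbox a b) (\<lambda>x. f' (x + 0 *\<^sub>R e) e)) (at 0 within UNIV)"
    unfolding g_def
  proof (rule leibniz_rule_vector_derivative)
    show "((\<lambda>t. f (x + t *\<^sub>R e)) has_vector_derivative f' (x + t *\<^sub>R e) e) (at t within UNIV)" for x t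
    proof -
      have "((\<lambda>t. f (x + t *\<^sub>R e)) has_derivative (\<lambda>h. f' (x + t *\<^sub>R e) (h *\<^sub>R e))) (at t)"
        by (rule has_derivative_compose[OF _ D, where f = "\<lambda>t. x + t *\<^sub>R e"])
          (auto intro!: derivative_eq_intros)
      then show ?thesis
        unfolding has_vector_derivative_def
        by (simp add: linear_cmul[OF has_derivative_linear[OF D]])
    qed
    show "(\<lambda>x. f (x + t *\<^sub>R e)) integrable_on cbox a b" for t
      by (rule integrable_continuous[OF contf'])
    show "continuous_on (UNIV \<times> cbox a b) (\<lambda>(t, x). f' (x + t *\<^sub>R e) e)"
      unfolding split_beta e_def
      by (rule continuous_on_compose2[OF cont]) (auto intro!: continuous_intros)
  qed auto
  then have "(g has_real_derivative integral (cbox a b) (\<lambda>x. f' x e)) (at 0)"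
    by (simp add: has_real_derivative_iff_has_vector_derivative)
  \<comment> \<open>The slab estimate concerns small positive \<open>t\<close>; since the derivative
    exists, the one-sided quotients determine it.\<close>
  then have "((\<lambda>t. (g t - g 0) / (t - 0)) \<longlongrightarrow> integral (cbox a b) (\<lambda>x. f' x e)) (at_right 0)"
    by (auto simp: has_field_derivative_iff intro: filterlim_mono[OF _ order_refl at_le])
  then have "((\<lambda>t. \<bar>(g t - g 0) / t\<bar>) \<longlongrightarrow> \<bar>integral (cbox a b) (\<lambda>x. f' x e)\<bar>) (at_right 0)"
    by (intro tendsto_rabs) simp
  moreover have "\<forall>\<^sub>F t in at_right 0. \<bar>(g t - g 0) / t\<bar> \<le> 2 * M * A"
  proof (rule eventually_mono)
    show "\<forall>\<^sub>F t in at_right 0. t \<in> {0<..<b $ i - a $ i}"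
      using ab[of i] by (intro eventually_at_right_real) simp
    show "\<bar>(g t - g 0) / t\<bar> \<le> 2 * M * A" if "t \<in> {0<..<b $ i - a $ i}" for t
      using that diff[of t] by (simp add: pos_divide_le_eq)
  qed
  ultimately have "\<bar>integral (cbox a b) (\<lambda>x. f' x e)\<bar> \<le> 2 * M * A"
    by (rule tendsto_upperbound) simp
  then show ?thesis by (simp add: e_def A_def)
qed

text \<open>Continuity gives integrability on the compact closure, a Borel set; this passes to
  \<open>K\<close>, which is only Lebesgue measurable.\<close>

lemma set_integrable_lebesgue_continuous:
  fixes f :: "real^'n \<Rightarrow> real"
  assumes cont: "continuous_on UNIV f" and K: "K \<in> sets lebesgue" "bounded K"
  shows "set_integrable lebesgue K f"
proof -
  have "compact (closure K)" using K by simp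
  then have "integrable lborel (\<lambda>x. indicator (closure K) x *\<^sub>R f x)"
    by (rule borel_integrable_compact) (rule continuous_on_subset[OF cont subset_UNIV])
  then have "set_integrable lebesgue (closure K) f"
    unfolding set_integrable_def by (simp add: integrable_completion)
  then show ?thesis
    by (rule set_integrable_subset) (use K closure_subset in auto)
qed

section \<open>The anisotropic norm and its polar\<close>

locale anisotropic_norm =
  fixes F :: "real^'n \<Rightarrow> real" and a :: real
  assumes convex: "convex_on UNIV F"
    and homogeneous: "\<And>t \<xi>. F (t *\<^sub>R \<xi>) = \<bar>t\<bar> * F \<xi>"
    and a_pos: "0 < a"
    and coercive: "\<And>\<xi>. a * norm \<xi> \<le> F \<xi>"
begin

lemma pos: "\<xi> \<noteq> 0 \<Longrightarrow> 0 < F \<xi>"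
  using coercive[of \<xi>] a_pos by (metis mult_pos_pos less_le_trans zero_less_norm_iff)

lemma zero: "F 0 = 0"
  using homogeneous[of 0 0] by simp

lemma nonneg: "0 \<le> F \<xi>"
  using pos[of \<xi>] zero by (cases "\<xi> = 0") auto

text \<open>A real supremum carries information only for a bounded set. Cauchy-Schwarz and
  coercivity give the bound \<open>norm v / a\<close>.\<close>

lemma polar_bdd: "bdd_above ((\<lambda>\<xi>. (\<xi> \<bullet> v) / F \<xi>) ` (- {0}))"
proof (rule bdd_aboveI2)
  fix \<xi> :: "real^'n" assume "\<xi> \<in> - {0}"
  then have "0 < F \<xi>" using pos by auto
  have "\<xi> \<bullet> v \<le> norm \<xi> * norm v" by (rule norm_cauchy_schwarz)
  also have "\<dots> \<le> (F \<xi> / a) * norm v"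
    using coercive[of \<xi>] a_pos by (intro mult_right_mono) (auto simp: field_simps)
  finally show "(\<xi> \<bullet> v) / F \<xi> \<le> norm v / a"
    using \<open>0 < F \<xi>\<close> a_pos by (simp add: field_simps)
qed

lemma inner_le_polar: "\<xi> \<bullet> v \<le> F \<xi> * polar_fun F v"
proof (cases "\<xi> = 0")
  case False
  then have "(\<xi> \<bullet> v) / F \<xi> \<le> polar_fun F v"
    unfolding polar_fun_def by (intro cSUP_upper polar_bdd) auto
  then show ?thesis using pos[OF False] by (simp add: field_simps)
qed (simp add: zero)

lemma polar_le:
  assumes "\<And>\<xi>. \<xi> \<bullet> v \<le> c * F \<xi>"
  shows "polar_fun F v \<le> c"
  unfolding polar_fun_def
proof (rule cSUP_least)
  show "- {0 :: real^'n} \<noteq> {}"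
    using axis_eq_0_iff[of undefined "1::real"] by (metis ComplI empty_iff singletonD zero_neq_one)
  show "\<xi> \<bullet> v / F \<xi> \<le> c" if "\<xi> \<in> - {0}" for \<xi>
    using assms[of \<xi>] pos[of \<xi>] that by (simp add: field_simps)
qed

lemma polar_nonneg: "0 \<le> polar_fun F v"
proof (cases "v = 0")
  case True
  have "axis undefined 1 \<bullet> v \<le> F (axis undefined 1) * polar_fun F v" by (rule inner_le_polar)
  then show ?thesis
    using pos[of "axis undefined 1"] True by (simp add: axis_eq_0_iff zero_le_mult_iff)
next
  case False
  have "0 < v \<bullet> v" using False by simp
  also have "\<dots> \<le> F v * polar_fun F v" by (rule inner_le_polar)
  finally show ?thesis using pos[OF False] by (simp add: zero_less_mult_iff)
qed

lemma abs_inner_le_polar: "\<bar>\<xi> \<bullet> v\<bar> \<le> F \<xi> * polar_fun F v"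
  using inner_le_polar[of \<xi> v] inner_le_polar[of "- \<xi>" v] homogeneous[of "-1" \<xi>] by auto

text \<open>Hahn-Banach in finite dimension: a functional \<open>w\<close> separating
  \<open>n\<close> from the convex sublevel set below \<open>F n\<close> is rescaled so as to take
  the value \<open>F n\<close> at \<open>n\<close>.\<close>

lemma dual_vector_exists:
  obtains z where "n \<bullet> z = F n" "\<And>\<xi>. \<xi> \<bullet> z \<le> F \<xi>"
proof (cases "n = 0")
  case True
  then show ?thesis using that[of 0] nonneg zero by auto
next
  case False
  define S where "S = {\<xi>. F \<xi> < F n}"
  have "convex S"
  proof (rule convexI)
    fix x y :: "real^'n" and u v :: real
    assume *: "x \<in> S" "y \<in> S" "0 \<le> u" "0 \<le> v" "u + v = 1"
    have "F (u *\<^sub>R x + v *\<^sub>R y) \<le> u * F x + v * F y"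
      using convex * unfolding convex_on_def by auto
    also have "\<dots> < F n" using * by (intro convex_bound_lt) (auto simp: S_def)
    finally show "u *\<^sub>R x + v *\<^sub>R y \<in> S" by (simp add: S_def)
  qed
  moreover have "0 \<in> S" using pos[OF False] zero by (simp add: S_def)
  moreover have "S \<inter> {n} = {}" by (auto simp: S_def)
  ultimately obtain w b where "w \<noteq> 0" and wS: "\<forall>x\<in>S. w \<bullet> x \<le> b" and "b \<le> w \<bullet> n"
    using separating_hyperplane_sets[of S "{n}"] by auto
  then have w: "w \<bullet> x \<le> w \<bullet> n" if "F x < F n" for x
    using that by (auto simp: S_def)
  have wn: "0 < w \<bullet> n"
  proof -
    \<comment> \<open>With this \<open>t\<close>, \<open>F (t *\<^sub>R w)\<close> is half of
      \<open>F n\<close>, so a positive multiple of \<open>w\<close> lies in \<open>S\<close>, and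
      the functional is positive there.\<close>
    define t where "t = F n / (2 * F w)"
    have "0 < t" using pos[OF False] pos[OF \<open>w \<noteq> 0\<close>] by (simp add: t_def)
    have "F (t *\<^sub>R w) < F n"
      using \<open>0 < t\<close> pos[OF False] pos[OF \<open>w \<noteq> 0\<close>] by (simp add: homogeneous t_def)
    from w[OF this] have "t * (w \<bullet> w) \<le> w \<bullet> n" by simp
    moreover have "0 < t * (w \<bullet> w)" using \<open>0 < t\<close> \<open>w \<noteq> 0\<close> by simp
    ultimately show ?thesis by linarith
  qed
  define z where "z = (F n / (w \<bullet> n)) *\<^sub>R w"
  show ?thesis
  proof (rule that[of z])
    show "n \<bullet> z = F n" using wn by (simp add: z_def inner_commute)
    fix \<xi>
    show "\<xi> \<bullet> z \<le> F \<xi>"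
    proof (cases "\<xi> = 0")
      case \<xi>: False
      \<comment> \<open>The vector \<xi> is rescaled to norm \<open>s * F n\<close>, strictly inside
        the sublevel set; afterwards \<open>s\<close> tends to 1.\<close>
      have "s * ((w \<bullet> \<xi>) * F n / F \<xi>) \<le> w \<bullet> n" if "0 < s" "s < 1" for s
      proof -
        have "F ((s * F n / F \<xi>) *\<^sub>R \<xi>) < F n"
          using that pos[OF False] pos[OF \<xi>] by (simp add: homogeneous)
        from w[OF this] show ?thesis by (simp add: mult_ac)
      qed
      then have "(w \<bullet> \<xi>) * F n / F \<xi> \<le> w \<bullet> n"
        by (rule field_le_mult_one_interval)
      then show ?thesis
        using wn pos[OF \<xi>] by (simp add: z_def inner_commute field_simps)
    qed (simp add: zero)
  qed
qed

section \<open>Anisotropic distance and supporting half spaces\<close>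

text \<open>The segment from \<open>x\<close> to \<open>y\<close> meets the frontier at some
  \<open>?w\<close> with \<open>x - ?w = t *\<^sub>R (x - y)\<close> and \<open>t\<close> in the
  unit interval, and the polar does not grow under such a contraction. So any exterior point may
  serve to bound the distance.\<close>

lemma anisotropic_dist_le:
  assumes "x \<in> \<Omega>" "y \<notin> \<Omega>"
  shows "anisotropic_dist F \<Omega> x \<le> ereal (polar_fun F (x - y))"
proof -
  have "closed_segment x y \<inter> frontier \<Omega> \<noteq> {}"
    using assms by (intro connected_Int_frontier) auto
  then obtain t where t: "0 \<le> t" "t \<le> 1" and fr: "(1 - t) *\<^sub>R x + t *\<^sub>R y \<in> frontier \<Omega>"
    by (auto simp: closed_segment_def)
  let ?w = "(1 - t) *\<^sub>R x + t *\<^sub>R y"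
  have "polar_fun F (x - ?w) \<le> polar_fun F (x - y)"
  proof (rule polar_le)
    fix \<xi>
    have "\<xi> \<bullet> (x - ?w) = t * (\<xi> \<bullet> (x - y))"
      by (simp add: inner_diff_right inner_add_right algebra_simps)
    also have "\<dots> \<le> t * \<bar>\<xi> \<bullet> (x - y)\<bar>"
      using t(1) by (intro mult_left_mono) auto
    also have "\<dots> \<le> \<bar>\<xi> \<bullet> (x - y)\<bar>"
      using t by (intro mult_left_le_one_le) auto
    also have "\<dots> \<le> polar_fun F (x - y) * F \<xi>"
      using abs_inner_le_polar[of \<xi> "x - y"] by (simp add: mult.commute)
    finally show "\<xi> \<bullet> (x - ?w) \<le> polar_fun F (x - y) * F \<xi>" .
  qed
  then show ?thesis
    unfolding anisotropic_dist_def using fr by (intro INF_lower2[of ?w]) auto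
qed

text \<open>The normalisation \<open>F n = 1\<close> makes the gap
  \<open>n \<bullet> (y - x)\<close> to the hyperplane at most the polar distance from
  \<open>x\<close> to \<open>y\<close>.\<close>

lemma supporting_half_space:
  assumes "open \<Omega>" "convex \<Omega>" "y \<in> frontier \<Omega>"
  obtains n where "F n = 1" "\<And>w. w \<in> \<Omega> \<Longrightarrow> n \<bullet> w \<le> n \<bullet> y"
proof -
  have "y \<notin> \<Omega>" using assms by (simp add: frontier_def interior_open)
  moreover have "\<Omega> \<noteq> {}" using assms by auto
  ultimately obtain m b where "m \<noteq> 0" "\<forall>x\<in>\<Omega>. m \<bullet> x \<le> b" "b \<le> m \<bullet> y"
    using separating_hyperplane_sets[of \<Omega> "{y}"] assms by auto
  then have m: "m \<bullet> w \<le> m \<bullet> y" if "w \<in> \<Omega>" for w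
    using that by fastforce
  show ?thesis
  proof (rule that[of "(1 / F m) *\<^sub>R m"])
    show "F ((1 / F m) *\<^sub>R m) = 1"
      using pos[OF \<open>m \<noteq> 0\<close>] by (simp add: homogeneous)
    show "(1 / F m) *\<^sub>R m \<bullet> w \<le> (1 / F m) *\<^sub>R m \<bullet> y" if "w \<in> \<Omega>" for w
      using m[OF that] pos[OF \<open>m \<noteq> 0\<close>] by (simp add: divide_right_mono)
  qed
qed

text \<open>A point of \<open>\<Omega>\<close> has a frontier point at polar distance below
  \<open>r\<close>, whose supporting half space works; a frontier point uses its own, with gap 0.
  The closure is included to make a compactness argument available.\<close>

lemma near_supporting_half_space:
  assumes "open \<Omega>" "convex \<Omega>" "x \<in> closure \<Omega>" "anisotropic_inradius F \<Omega> < ereal r" "0 < r"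
  obtains n c where "F n = 1" "\<And>w. w \<in> \<Omega> \<Longrightarrow> n \<bullet> w \<le> c" "c - r < n \<bullet> x"
proof (cases "x \<in> \<Omega>")
  case True
  have "anisotropic_dist F \<Omega> x \<le> anisotropic_inradius F \<Omega>"
    unfolding anisotropic_inradius_def using True by (rule SUP_upper)
  then have "anisotropic_dist F \<Omega> x < ereal r" using assms by simp
  then obtain y where y: "y \<in> frontier \<Omega>" "polar_fun F (x - y) < r"
    unfolding anisotropic_dist_def by (auto simp: INF_less_iff)
  obtain n where n: "F n = 1" "\<And>w. w \<in> \<Omega> \<Longrightarrow> n \<bullet> w \<le> n \<bullet> y"
    using supporting_half_space[OF assms(1,2) y(1)] by blast
  have "\<bar>n \<bullet> (x - y)\<bar> < r"
    using abs_inner_le_polar[of n "x - y"] n y by simp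
  then show ?thesis
    by (intro that[of n "n \<bullet> y"] n) (auto simp: inner_diff_right)
next
  case False
  then have "x \<in> frontier \<Omega>" using assms by (simp add: frontier_def interior_open)
  then obtain n where n: "F n = 1" "\<And>w. w \<in> \<Omega> \<Longrightarrow> n \<bullet> w \<le> n \<bullet> x"
    using supporting_half_space[OF assms(1,2)] by blast
  then show ?thesis
    using assms(5) by (intro that[of n "n \<bullet> x"] n) auto
qed

text \<open>The conditions \<open>c - r < n \<bullet> x\<close> define open sets that cover the
  compact closure of \<open>\<Omega>\<close>; \<open>I\<close> is a finite subcover.\<close>

lemma finite_near_supporting_half_spaces:
  assumes "bounded \<Omega>" "open \<Omega>" "convex \<Omega>" "anisotropic_inradius F \<Omega> < ereal r" "0 < r"
  obtains I where "finite I" "\<And>n c. (n, c) \<in> I \<Longrightarrow> F n = 1"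
    "\<And>n c w. (n, c) \<in> I \<Longrightarrow> w \<in> \<Omega> \<Longrightarrow> n \<bullet> w \<le> c"
    "\<And>x. x \<in> \<Omega> \<Longrightarrow> \<exists>(n, c)\<in>I. c - r < n \<bullet> x"
proof -
  define J where "J = {(n, c). F n = 1 \<and> (\<forall>w\<in>\<Omega>. n \<bullet> w \<le> c)}"
  define U where "U = (\<lambda>(n, c). {x :: real^'n. c - r < n \<bullet> x})"
  have "compact (closure \<Omega>)" using assms by simp
  moreover have "\<And>i. i \<in> J \<Longrightarrow> open (U i)"
    by (simp add: U_def split_beta open_halfspace_gt)
  moreover have "closure \<Omega> \<subseteq> (\<Union>i\<in>J. U i)"
  proof
    fix x assume "x \<in> closure \<Omega>"
    then obtain n c where "F n = 1" "\<And>w. w \<in> \<Omega> \<Longrightarrow> n \<bullet> w \<le> c" "c - r < n \<bullet> x"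
      using near_supporting_half_space[OF assms(2,3) _ assms(4,5)] by blast
    then show "x \<in> (\<Union>i\<in>J. U i)" by (auto simp: J_def U_def intro!: bexI[of _ "(n, c)"])
  qed
  ultimately obtain I where I: "I \<subseteq> J" "finite I" "closure \<Omega> \<subseteq> (\<Union>i\<in>I. U i)"
    by (rule compactE_image)
  show ?thesis
  proof (rule that[OF I(2)])
    fix x assume "x \<in> \<Omega>"
    then obtain i where "i \<in> I" "x \<in> U i" using I closure_subset by blast
    then show "\<exists>(n, c)\<in>I. c - r < n \<bullet> x" by (auto simp: U_def)
  qed (use I J_def in auto)
qed


section \<open>The calibrating field\<close>

text \<open>Compact support comes from a radial cutoff \<eta>, equal to 1 with vanishing derivative
  on \<open>\<Omega>\<close>, so it leaves the divergence there unchanged. The loss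
  \<open>\<delta>\<close> in the numerator is the softmax weight of far half spaces; the loss
  \<open>2 * \<delta>\<close> in the denominator lengthens the ramp.\<close>

lemma calibrating_field_exists:
  assumes "bounded \<Omega>" "open \<Omega>" "convex \<Omega>" "\<Omega> \<noteq> {}"
    and "anisotropic_inradius F \<Omega> < ereal r" "0 < r" "0 < \<delta>"
  obtains \<sigma> where "\<sigma> \<in> C1_compact_support" "\<And>x. polar_fun F (\<sigma> x) \<le> 1"
    "continuous_on UNIV (divergence \<sigma>)"
    "\<And>x. x \<in> \<Omega> \<Longrightarrow> (1 - \<delta>) / (r + 2 * \<delta>) \<le> divergence \<sigma> x"
proof -
  obtain I where I: "finite I" "\<And>n c. (n, c) \<in> I \<Longrightarrow> F n = 1"
    "\<And>n c w. (n, c) \<in> I \<Longrightarrow> w \<in> \<Omega> \<Longrightarrow> n \<bullet> w \<le> c"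
    "\<And>x. x \<in> \<Omega> \<Longrightarrow> \<exists>(n, c)\<in>I. c - r < n \<bullet> x"
    using finite_near_supporting_half_spaces[OF assms(1-3,5,6)] by blast
  have "I \<noteq> {}" using I(4) assms(4) by fastforce
  have "\<exists>z. n \<bullet> z = F n \<and> (\<forall>\<xi>. \<xi> \<bullet> z \<le> F \<xi>)" for n
    by (rule dual_vector_exists[of n]) blast
  then obtain z where z: "\<And>n. n \<bullet> z n = F n" "\<And>n \<xi>. \<xi> \<bullet> z n \<le> F \<xi>"
    by metis
  obtain B where B: "\<And>x. x \<in> \<Omega> \<Longrightarrow> norm x \<le> B"
    using assms(1) by (auto simp: bounded_iff)
  \<comment> \<open>For a height \<open>s\<close> with \<open>- r - \<delta> < s\<close> and
    \<open>s \<le> 0\<close>, the shifted argument \<open>s + L\<close> lies between \<delta> and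
    \<open>L\<close>, exactly where the ramp has slope \<open>1 / L\<close>.\<close>
  define L where "L = r + 2 * \<delta>"
  have "0 < L" using assms by (simp add: L_def)
  obtain \<beta> \<beta>' :: "real \<Rightarrow> real" where \<beta>: "\<And>s. (\<beta> has_real_derivative \<beta>' s) (at s)" "continuous_on UNIV \<beta>'"
    "\<And>s. 0 \<le> \<beta>' s" "\<And>s. 0 \<le> \<beta> s" "\<And>s. \<beta> s \<le> 1"
    "\<And>s. \<delta> \<le> s \<Longrightarrow> s \<le> L \<Longrightarrow> \<beta>' s = 1 / L"
    by (rule C1_ramp_exists[OF \<open>0 < L\<close> \<open>0 < \<delta>\<close>]) blast
  \<comment> \<open>This second ramp rises from 0 to 1 between 0 and 2. Applied to
    \<open>x \<bullet> x - B\<^sup>2\<close> it confines the support to the ball of radius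
    \<open>sqrt (B\<^sup>2 + 2)\<close>.\<close>
  obtain \<gamma> \<gamma>' :: "real \<Rightarrow> real" where \<gamma>: "\<And>s. (\<gamma> has_real_derivative \<gamma>' s) (at s)" "continuous_on UNIV \<gamma>'"
    "\<And>s. 0 \<le> \<gamma> s" "\<And>s. \<gamma> s \<le> 1" "\<And>s. s \<le> 0 \<Longrightarrow> \<gamma> s = 0" "\<And>s. s \<le> 0 \<Longrightarrow> \<gamma>' s = 0"
    "\<And>s. 1 + 1 \<le> s \<Longrightarrow> \<gamma> s = 1"
    by (rule C1_ramp_exists[of 1 1]) (simp, simp, blast)
  define N where "N = real (card I)"
  have "1 \<le> N" using I(1) \<open>I \<noteq> {}\<close> by (simp add: N_def Suc_le_eq card_gt_0_iff)
  \<comment> \<open>Chosen so that \<open>\<delta> * \<kappa> = N / \<delta>\<close>; then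
    \<open>u \<le> exp u\<close> at \<open>u = N / \<delta>\<close> bounds the total far weight
    \<open>N * exp (- (\<delta> * \<kappa>))\<close> by \<delta>.\<close>
  define \<kappa> where "\<kappa> = N / \<delta>\<^sup>2"
  have "0 < \<kappa>" using \<open>1 \<le> N\<close> assms by (simp add: \<kappa>_def)
  have \<kappa>: "N * exp (- (\<delta> * \<kappa>)) \<le> \<delta>"
  proof -
    have "N / \<delta> \<le> exp (N / \<delta>)"
      using exp_ge_add_one_self[of "N / \<delta>"] by linarith
    then have "N * exp (- (N / \<delta>)) \<le> \<delta>"
      using assms \<open>1 \<le> N\<close> by (simp add: exp_minus field_simps)
    moreover have "\<delta> * \<kappa> = N / \<delta>"
      using assms by (simp add: \<kappa>_def power2_eq_square)
    ultimately show ?thesis by simp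
  qed
  define s :: "(real^'n) \<times> real \<Rightarrow> real^'n \<Rightarrow> real" where "s i x = fst i \<bullet> x - snd i" for i x
  define e where "e i x = exp (\<kappa> * s i x)" for i x
  define S where "S x = (\<Sum>i\<in>I. e i x)" for x
  define p where "p i x = e i x / S x" for i x
  define \<eta> :: "real^'n \<Rightarrow> real" where "\<eta> x = 1 - \<gamma> (x \<bullet> x - B\<^sup>2)" for x
  define b where "b i x = \<beta> (s i x + L)" for i x
  define b' where "b' i x = \<beta>' (s i x + L)" for i x
  \<comment> \<open>The weighted mean of the normals in direction \<open>h\<close>. The logarithmic
    derivative of \<open>S\<close> is \<kappa> times this mean, which gives the softmax derivative
    its centred form.\<close>
  define m where "m x h = (\<Sum>j\<in>I. p j x * (fst j \<bullet> h))" for x h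
  define g where "g i x = \<eta> x * (p i x * b i x)" for i x
  define g' where "g' i x h = \<eta> x * (p i x * (b' i x * (fst i \<bullet> h)) + p i x * (\<kappa> * (fst i \<bullet> h - m x h)) * b i x)
      - \<gamma>' (x \<bullet> x - B\<^sup>2) * (2 * (x \<bullet> h)) * (p i x * b i x)" for i x h
  have e_pos: "0 < e i x" for i x by (simp add: e_def)
  have S_pos: "0 < S x" for x
    unfolding S_def using e_pos I(1) \<open>I \<noteq> {}\<close> by (intro sum_pos) auto
  have p_nonneg: "0 \<le> p i x" for i x
    using e_pos S_pos by (simp add: p_def less_imp_le)
  have p_sum: "(\<Sum>i\<in>I. p i x) = 1" for x
    using S_pos[of x] by (simp add: p_def sum_divide_distrib[symmetric] S_def[symmetric])
  have De: "(e i has_derivative (\<lambda>h. e i x * (\<kappa> * (fst i \<bullet> h)))) (at x)" for i x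
    unfolding e_def s_def by (auto intro!: derivative_eq_intros)
  have DS: "(S has_derivative (\<lambda>h. S x * (\<kappa> * m x h))) (at x)" for x
  proof -
    have "(S has_derivative (\<lambda>h. \<Sum>i\<in>I. e i x * (\<kappa> * (fst i \<bullet> h)))) (at x)"
      unfolding S_def by (intro has_derivative_sum De)
    moreover have "(\<Sum>i\<in>I. e i x * (\<kappa> * (fst i \<bullet> h))) = S x * (\<kappa> * m x h)" for h
      using S_pos[of x] by (simp add: m_def p_def sum_distrib_left mult_ac)
    ultimately show ?thesis by simp
  qed
  have Dp: "(p i has_derivative (\<lambda>h. p i x * (\<kappa> * (fst i \<bullet> h - m x h)))) (at x)" for i x
  proof -
    have "(p i has_derivative (\<lambda>h. (e i x * (\<kappa> * (fst i \<bullet> h)) * S x - e i x * (S x * (\<kappa> * m x h))) / (S x * S x))) (at x)"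
      unfolding p_def using S_pos[of x] by (intro has_derivative_divide' De DS) auto
    moreover have "(e i x * (\<kappa> * (fst i \<bullet> h)) * S x - e i x * (S x * (\<kappa> * m x h))) / (S x * S x)
        = p i x * (\<kappa> * (fst i \<bullet> h - m x h))" for h
      using S_pos[of x] by (simp add: p_def field_simps)
    ultimately show ?thesis by simp
  qed
  have Db: "(b i has_derivative (\<lambda>h. b' i x * (fst i \<bullet> h))) (at x)" for i x
    unfolding b_def b'_def s_def
    by (rule has_derivative_compose[OF _ \<beta>(1)[unfolded has_field_derivative_def], where f = "\<lambda>x. fst i \<bullet> x - snd i + L"])
      (auto intro!: derivative_eq_intros)
  have D\<eta>: "(\<eta> has_derivative (\<lambda>h. - (\<gamma>' (x \<bullet> x - B\<^sup>2) * (2 * (x \<bullet> h))))) (at x)" for x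
  proof -
    have "((\<lambda>x. \<gamma> (x \<bullet> x - B\<^sup>2)) has_derivative (\<lambda>h. \<gamma>' (x \<bullet> x - B\<^sup>2) * (2 * (x \<bullet> h)))) (at x)"
      by (rule has_derivative_compose[OF _ \<gamma>(1)[unfolded has_field_derivative_def], where f = "\<lambda>x. x \<bullet> x - B\<^sup>2"])
        (auto intro!: derivative_eq_intros simp: inner_commute)
    then show ?thesis
      unfolding \<eta>_def by (auto intro!: derivative_eq_intros)
  qed
  have Dg: "(g i has_derivative g' i x) (at x)" for i x
  proof -
    have "(g i has_derivative (\<lambda>h. \<eta> x * (p i x * (b' i x * (fst i \<bullet> h)) + p i x * (\<kappa> * (fst i \<bullet> h - m x h)) * b i x)
        + - (\<gamma>' (x \<bullet> x - B\<^sup>2) * (2 * (x \<bullet> h))) * (p i x * b i x))) (at x)"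
      unfolding g_def by (intro has_derivative_mult D\<eta> Dp Db)
    then show ?thesis by (simp add: g'_def[abs_def])
  qed
  have cont_of_deriv: "continuous_on UNIV f" if "\<And>x. (f has_derivative f' x) (at x)" for f :: "real^'n \<Rightarrow> real" and f'
    using that by (meson continuous_at_imp_continuous_on has_derivative_continuous)
  have cont_g': "continuous_on UNIV (\<lambda>x. g' i x h)" for i h
  proof -
    have "continuous_on UNIV (\<lambda>x. b' i x)"
      unfolding b'_def s_def by (rule continuous_on_compose2[OF \<beta>(2)]) (auto intro!: continuous_intros)
    moreover have "continuous_on UNIV (\<lambda>x. \<gamma>' (x \<bullet> x - B\<^sup>2))"
      by (rule continuous_on_compose2[OF \<gamma>(2)]) (auto intro!: continuous_intros)
    ultimately show ?thesis
      unfolding g'_def m_def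
      using cont_of_deriv[OF Dp] cont_of_deriv[OF Db] cont_of_deriv[OF D\<eta>]
      by (intro continuous_intros) auto
  qed
  define \<sigma> where "\<sigma> x = (\<Sum>i\<in>I. g i x *\<^sub>R z (fst i))" for x
  have D\<sigma>: "(\<sigma> has_derivative (\<lambda>h. \<Sum>i\<in>I. g' i x h *\<^sub>R z (fst i))) (at x)" for x
    unfolding \<sigma>_def by (intro has_derivative_sum has_derivative_scaleR_left Dg)
  have div: "divergence \<sigma> x = (\<Sum>i\<in>I. g' i x (z (fst i)))" for x
    unfolding \<sigma>_def[abs_def] by (rule divergence_sum_scaleR[OF Dg])
  have g_nonneg: "0 \<le> g i x" for i x
    unfolding g_def \<eta>_def b_def using p_nonneg \<beta>(4) \<gamma>(4) by simp
  have g_le: "g i x \<le> p i x" for i x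
  proof -
    have "p i x * b i x \<le> p i x"
      unfolding b_def by (rule mult_left_le[OF \<beta>(5) p_nonneg])
    moreover have "0 \<le> p i x * b i x"
      unfolding b_def using p_nonneg \<beta>(4) by simp
    moreover have "g i x \<le> p i x * b i x"
      unfolding g_def \<eta>_def using calculation \<gamma>(3,4) by (intro mult_left_le_one_le) auto
    ultimately show ?thesis by linarith
  qed
  show ?thesis
  proof (rule that[of \<sigma>])
    have "\<sigma> x = 0" if "sqrt (B\<^sup>2 + 2) < norm x" for x
    proof -
      have "B\<^sup>2 + 2 \<le> x \<bullet> x"
        using power_mono[of "sqrt (B\<^sup>2 + 2)" "norm x" 2] that by (simp add: power2_norm_eq_inner)
      then show ?thesis by (simp add: \<sigma>_def g_def \<eta>_def \<gamma>(7))
    qed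
    then have "{x. \<sigma> x \<noteq> 0} \<subseteq> cball 0 (sqrt (B\<^sup>2 + 2))"
      by (force simp: not_less[symmetric])
    then have "compact (closure {x. \<sigma> x \<noteq> 0})"
      by (meson bounded_cball bounded_subset compact_closure)
    moreover have "continuous_on UNIV (partial_deriv k \<sigma>)" for k
      unfolding partial_deriv_has_derivative[OF D\<sigma>, abs_def]
      by (intro continuous_intros cont_g')
    ultimately show "\<sigma> \<in> C1_compact_support"
      unfolding C1_compact_support_def using D\<sigma> by (auto simp: differentiable_def)
  next
    fix x
    show "polar_fun F (\<sigma> x) \<le> 1"
    proof (rule polar_le)
      fix \<xi>
      have "\<xi> \<bullet> \<sigma> x = (\<Sum>i\<in>I. g i x * (\<xi> \<bullet> z (fst i)))"
        by (simp add: \<sigma>_def inner_sum_right)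
      \<comment> \<open>The inner product may be negative, so it is first replaced by the
        nonnegative \<open>F \<xi>\<close>, and only then is the weight \<open>g\<close> enlarged to
        \<open>p\<close>.\<close>
      also have "\<dots> \<le> (\<Sum>i\<in>I. p i x * F \<xi>)"
        by (intro sum_mono order_trans[OF mult_left_mono[OF z(2) g_nonneg]] mult_right_mono g_le nonneg)
      also have "\<dots> = 1 * F \<xi>"
        by (simp only: sum_distrib_right[symmetric] p_sum)
      finally show "\<xi> \<bullet> \<sigma> x \<le> 1 * F \<xi>" .
    qed
  next
    show "continuous_on UNIV (divergence \<sigma>)"
      unfolding div[abs_def] by (intro continuous_on_sum cont_g')
  next
    fix x assume x: "x \<in> \<Omega>"
    have "x \<bullet> x \<le> B\<^sup>2"
      using power_mono[OF B[OF x], of 2] by (simp add: power2_norm_eq_inner)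
    then have *: "\<eta> x = 1" "\<gamma>' (x \<bullet> x - B\<^sup>2) = 0"
      using \<gamma>(5,6) by (auto simp: \<eta>_def)
    \<comment> \<open>The threshold leaves a margin \<delta> below the level \<open>- r\<close>
      exceeded by \<open>i0\<close>. Outside \<open>G\<close> the height is thus at least \<delta>
      below that of \<open>i0\<close>, and the softmax weight is at most
      \<open>exp (- (\<delta> * \<kappa>))\<close>.\<close>
    define G where "G = {i \<in> I. - r - \<delta> < s i x}"
    obtain i0 where i0: "i0 \<in> I" "- r < s i0 x"
      using I(4)[OF x] by (force simp: s_def)
    have "(\<Sum>i\<in>I - G. p i x) \<le> (\<Sum>i\<in>I - G. exp (- (\<delta> * \<kappa>)))"
    proof (rule sum_mono)
      fix i assume "i \<in> I - G"
      then have "s i x \<le> s i0 x - \<delta>" using i0 by (auto simp: G_def)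
      then have "\<kappa> * s i x \<le> - (\<delta> * \<kappa>) + \<kappa> * s i0 x"
        using mult_left_mono[of "s i x" "s i0 x - \<delta>" \<kappa>] \<open>0 < \<kappa>\<close> by (simp add: algebra_simps)
      then have "e i x \<le> exp (- (\<delta> * \<kappa>)) * e i0 x"
        by (simp add: e_def exp_add[symmetric])
      also have "\<dots> \<le> exp (- (\<delta> * \<kappa>)) * S x"
        unfolding S_def using i0 I(1) e_pos by (intro mult_left_mono member_le_sum) (auto simp: less_imp_le)
      finally show "p i x \<le> exp (- (\<delta> * \<kappa>))"
        using S_pos[of x] by (simp add: p_def field_simps)
    qed
    also have "\<dots> \<le> N * exp (- (\<delta> * \<kappa>))"
      using I(1) by (auto simp: N_def intro!: mult_right_mono card_mono)
    also note \<kappa>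
    finally have bad: "(\<Sum>i\<in>I - G. p i x) \<le> \<delta>" .
    have "(1 - \<delta>) / L \<le> (\<Sum>i\<in>G. p i x) / L"
      using bad p_sum[of x] sum.subset_diff[of G I "\<lambda>i. p i x"] I(1) \<open>0 < L\<close>
      by (intro divide_right_mono) (auto simp: G_def)
    also have "\<dots> = (\<Sum>i\<in>G. p i x * b' i x)"
    proof -
      have "b' i x = 1 / L" if "i \<in> G" for i
        using that I(3)[of "fst i" "snd i" x] x
        unfolding b'_def G_def by (intro \<beta>(6)) (auto simp: L_def s_def)
      then show ?thesis by (simp add: sum_divide_distrib)
    qed
    also have "\<dots> \<le> (\<Sum>i\<in>I. p i x * b' i x)"
      using I(1) p_nonneg \<beta>(3) by (intro sum_mono2) (auto simp: G_def b'_def)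
    also have "\<dots> \<le> (\<Sum>i\<in>I. g' i x (z (fst i)))"
    proof (rule sum_mono)
      fix i assume i: "i \<in> I"
      then have 1: "fst i \<bullet> z (fst i) = 1" using z(1) I(2) by (metis prod.collapse)
      have "m x (z (fst i)) \<le> (\<Sum>j\<in>I. p j x * 1)"
        unfolding m_def
      proof (intro sum_mono mult_left_mono p_nonneg)
        fix j assume "j \<in> I"
        then show "fst j \<bullet> z (fst i) \<le> 1" using z(2)[of "fst j" "fst i"] I(2) by (metis prod.collapse)
      qed
      then have "m x (z (fst i)) \<le> 1" using p_sum by simp
      then have "0 \<le> p i x * (\<kappa> * (fst i \<bullet> z (fst i) - m x (z (fst i)))) * b i x"
        unfolding 1 b_def using p_nonneg \<beta>(4) \<open>0 < \<kappa>\<close> by (intro mult_nonneg_nonneg) auto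
      then show "p i x * b' i x \<le> g' i x (z (fst i))"
        by (simp add: g'_def * 1)
    qed
    finally show "(1 - \<delta>) / (r + 2 * \<delta>) \<le> divergence \<sigma> x"
      by (simp add: div L_def)
  qed
qed

section \<open>The lower bound for the Cheeger constant\<close>

text \<open>The calibrating field competes in the perimeter of \<open>K\<close>; its divergence
  bound is integrated over \<open>K\<close> before \<delta> tends to 0.\<close>

lemma measure_le_perimeter:
  assumes "bounded \<Omega>" "open \<Omega>" "convex \<Omega>"
    and "K \<in> sets lebesgue" "K \<subseteq> \<Omega>" "\<Omega> \<noteq> {}"
    and "anisotropic_inradius F \<Omega> < ereal r" "0 < r"
  shows "ereal (measure lebesgue K / r) \<le> anisotropic_perimeter F K"
proof -
  have K: "K \<in> lmeasurable"
    using assms bounded_set_imp_lmeasurable bounded_subset by blast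
  have *: "ereal ((1 - \<delta>) / (r + 2 * \<delta>) * measure lebesgue K) \<le> anisotropic_perimeter F K" if \<delta>: "0 < \<delta>" for \<delta>
  proof -
    obtain \<sigma> where \<sigma>: "\<sigma> \<in> C1_compact_support" "\<And>x. polar_fun F (\<sigma> x) \<le> 1"
      "continuous_on UNIV (divergence \<sigma>)"
      "\<And>x. x \<in> \<Omega> \<Longrightarrow> (1 - \<delta>) / (r + 2 * \<delta>) \<le> divergence \<sigma> x"
      using calibrating_field_exists[OF assms(1-3,6-8) \<delta>] by blast
    have int: "set_integrable lebesgue K (divergence \<sigma>)"
      using \<sigma>(3) assms(4) bounded_subset[OF assms(1,5)] by (rule set_integrable_lebesgue_continuous)
    have "(1 - \<delta>) / (r + 2 * \<delta>) * measure lebesgue K = (LINT x:K|lebesgue. (1 - \<delta>) / (r + 2 * \<delta>))"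
      using K by (simp add: set_lebesgue_integral_def)
    also have "\<dots> \<le> (LINT x:K|lebesgue. divergence \<sigma> x)"
      using \<sigma>(4) assms(4,5) bounded_subset[OF assms(1,5)]
      by (intro set_integral_mono int set_integrable_lebesgue_continuous) auto
    finally show ?thesis
      unfolding anisotropic_perimeter_def using \<sigma>(1,2) by (intro SUP_upper2[of \<sigma>]) auto
  qed
  have "((\<lambda>\<delta>. ereal ((1 - \<delta>) / (r + 2 * \<delta>) * measure lebesgue K)) \<longlongrightarrow>
      ereal ((1 - 0) / (r + 2 * 0) * measure lebesgue K)) (at_right 0)"
    using assms by (intro tendsto_intros) auto
  moreover have "\<forall>\<^sub>F \<delta> in at_right 0.
      ereal ((1 - \<delta>) / (r + 2 * \<delta>) * measure lebesgue K) \<le> anisotropic_perimeter F K"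
    by (rule eventually_mono[OF eventually_at_right_less *])
  ultimately have "ereal ((1 - 0) / (r + 2 * 0) * measure lebesgue K) \<le> anisotropic_perimeter F K"
    by (rule tendsto_upperbound) simp
  then show ?thesis by simp
qed

lemma anisotropic_inradius_nonneg:
  assumes "\<Omega> \<noteq> {}"
  shows "0 \<le> anisotropic_inradius F \<Omega>"
proof -
  obtain x where "x \<in> \<Omega>" using assms by auto
  then show ?thesis
    unfolding anisotropic_inradius_def anisotropic_dist_def using polar_nonneg
    by (intro SUP_upper2[of x] INF_greatest) auto
qed

text \<open>With finite inradius and perimeter, \<open>measure_le_perimeter\<close> is used for all
  \<open>r\<close> above the inradius and \<open>r\<close> decreases to it. An infinite inradius
  makes the left side 0; an infinite perimeter makes the right side infinite.\<close>

theorem inverse_inradius_le_cheeger: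
  assumes "bounded \<Omega>" "open \<Omega>" "convex \<Omega>"
  shows "1 / anisotropic_inradius F \<Omega> \<le> anisotropic_cheeger F \<Omega>"
  unfolding anisotropic_cheeger_def
proof (rule INF_greatest)
  fix K assume "K \<in> {K \<in> sets lebesgue. K \<subseteq> \<Omega> \<and> 0 < emeasure lebesgue K}"
  then have K: "K \<in> sets lebesgue" "K \<subseteq> \<Omega>" "0 < emeasure lebesgue K" by auto
  \<comment> \<open>For empty \<open>\<Omega>\<close> there is no such \<open>K\<close>, and the
    infimum over the empty family is infinite.\<close>
  then have "\<Omega> \<noteq> {}" by auto
  define v where "v = measure lebesgue K"
  have "K \<in> lmeasurable"
    using K assms bounded_set_imp_lmeasurable bounded_subset by blast
  then have v: "emeasure lebesgue K = ennreal v"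
    unfolding v_def by (simp add: emeasure_eq_measure2)
  then have "0 < v" using K(3) by simp
  note P = measure_le_perimeter[OF assms K(1,2) \<open>\<Omega> \<noteq> {}\<close>, folded v_def]
  have P0: "0 \<le> anisotropic_perimeter F K"
  proof -
    have "(\<lambda>x. 0) \<in> {\<sigma> \<in> C1_compact_support. \<forall>x. polar_fun F (\<sigma> x) \<le> 1}"
      using polar_le[of 0 1] nonneg
      by (auto simp: C1_compact_support_def partial_deriv_has_derivative[OF has_derivative_const])
    then show ?thesis
      unfolding anisotropic_perimeter_def
      by (rule SUP_upper2)
        (simp add: divergence_def[abs_def] partial_deriv_has_derivative[OF has_derivative_const])
  qed
  have "1 / anisotropic_inradius F \<Omega> \<le> anisotropic_perimeter F K / ereal v"
  proof (cases "anisotropic_inradius F \<Omega>")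
    case (real \<rho>)
    then have "0 \<le> \<rho>" using anisotropic_inradius_nonneg[OF \<open>\<Omega> \<noteq> {}\<close>] by simp
    show ?thesis
    proof (cases "anisotropic_perimeter F K")
      case q: (real q)
      have "v \<le> q * r" if "\<rho> < r" for r
        using P[of r] that real q \<open>0 \<le> \<rho>\<close> by (simp add: field_simps)
      then have "v \<le> q * \<rho>"
        by (intro tendsto_lowerbound[of "\<lambda>r. q * r" "q * \<rho>" "at_right \<rho>" v] tendsto_intros
            eventually_mono[OF eventually_at_right_less]) auto
      \<comment> \<open>This excludes inradius 0, for which the left side would be infinite in the
        extended reals.\<close>
      then have "0 < \<rho>" using \<open>0 \<le> \<rho>\<close> \<open>0 < v\<close> by (cases "\<rho> = 0") auto
      then show ?thesis
        using \<open>v \<le> q * \<rho>\<close> \<open>0 < v\<close> by (simp add: real q one_ereal_def field_simps)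
    next
      case PInf
      then show ?thesis using \<open>0 < v\<close> by simp
    next
      case MInf
      then show ?thesis using P0 by simp
    qed
  next
    case PInf
    then show ?thesis using P0 \<open>0 < v\<close> by simp
  next
    case MInf
    then show ?thesis using anisotropic_inradius_nonneg[OF \<open>\<Omega> \<noteq> {}\<close>] by simp
  qed
  then show "1 / anisotropic_inradius F \<Omega> \<le> anisotropic_perimeter F K / enn2ereal (emeasure lebesgue K)"
    using \<open>0 < v\<close> by (simp add: v enn2ereal_ennreal)
qed

section \<open>Boxes and optimality\<close>

text \<open>Moving from \<open>x\<close> along the dual vector \<open>z\<close> of the axis,
  forwards and backwards, reaches the two opposite faces after times \<open>t1\<close> and
  \<open>t2\<close>. Polar distance is at most the time, and the smaller time is at most the
  mean.\<close>

lemma anisotropic_inradius_box_le: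
  "anisotropic_inradius F (box u v) \<le> ereal ((v $ i - u $ i) / (2 * F (axis i 1)))"
  unfolding anisotropic_inradius_def
proof (rule SUP_least)
  fix x assume x: "x \<in> box u v"
  have Fi: "0 < F (axis i 1)" by (rule pos) (simp add: axis_eq_0_iff)
  obtain z where z: "axis i 1 \<bullet> z = F (axis i 1)" "\<And>\<xi>. \<xi> \<bullet> z \<le> F \<xi>"
    using dual_vector_exists by blast
  have zi: "z $ i = F (axis i 1)" using z(1) by (simp add: inner_axis')
  have dist: "anisotropic_dist F (box u v) x \<le> ereal \<bar>t\<bar>" if "x + t *\<^sub>R z \<notin> box u v" for t
  proof -
    have "anisotropic_dist F (box u v) x \<le> ereal (polar_fun F (x - (x + t *\<^sub>R z)))"
      by (rule anisotropic_dist_le[OF x that])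
    also have "polar_fun F (x - (x + t *\<^sub>R z)) \<le> \<bar>t\<bar>"
    proof (rule polar_le)
      fix \<xi>
      have "\<xi> \<bullet> (x - (x + t *\<^sub>R z)) = ((- t) *\<^sub>R \<xi>) \<bullet> z" by simp
      also have "\<dots> \<le> F ((- t) *\<^sub>R \<xi>)" by (rule z(2))
      also have "\<dots> = \<bar>t\<bar> * F \<xi>" by (subst homogeneous) simp
      finally show "\<xi> \<bullet> (x - (x + t *\<^sub>R z)) \<le> \<bar>t\<bar> * F \<xi>" .
    qed
    finally show ?thesis by simp
  qed
  have xi: "u $ i < x $ i" "x $ i < v $ i" using x by (auto simp: mem_box_cart)
  define t1 where "t1 = (v $ i - x $ i) / F (axis i 1)"
  define t2 where "t2 = (x $ i - u $ i) / F (axis i 1)"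
  have "x + t1 *\<^sub>R z \<notin> box u v" "x + (- t2) *\<^sub>R z \<notin> box u v"
    using Fi by (auto simp: mem_box_cart t1_def t2_def zi intro!: exI[of _ i])
  from this[THEN dist] have "anisotropic_dist F (box u v) x \<le> ereal (min t1 t2)"
    using xi Fi by (auto simp: t1_def t2_def min_def)
  also have "min t1 t2 \<le> (t1 + t2) / 2" by (simp add: min_def)
  also have "(t1 + t2) / 2 = (v $ i - u $ i) / (2 * F (axis i 1))"
    using Fi by (simp add: t1_def t2_def field_simps)
  finally show "anisotropic_dist F (box u v) x \<le> ereal ((v $ i - u $ i) / (2 * F (axis i 1)))"
    by simp
qed

text \<open>Duality bounds the component \<open>\<sigma> x $ i\<close> by
  \<open>F (axis i 1)\<close>, so each diagonal term of the divergence contributes at most the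
  anisotropic area of the two faces orthogonal to that axis.\<close>

lemma anisotropic_perimeter_box_le:
  assumes uv: "\<And>i. u $ i < v $ i"
  shows "anisotropic_perimeter F (box u v) \<le>
    ereal (\<Sum>i\<in>UNIV. 2 * F (axis i 1) * (\<Prod>j\<in>- {i}. v $ j - u $ j))"
  unfolding anisotropic_perimeter_def
proof (rule SUP_least)
  fix \<sigma> assume "\<sigma> \<in> {\<sigma> \<in> C1_compact_support. \<forall>x. polar_fun F (\<sigma> x) \<le> 1}"
  then have \<sigma>: "\<And>x. \<sigma> differentiable (at x)" "\<And>i. continuous_on UNIV (partial_deriv i \<sigma>)"
    "\<And>x. polar_fun F (\<sigma> x) \<le> 1"
    by (auto simp: C1_compact_support_def)
  have cont: "continuous_on S (\<lambda>x. partial_deriv i \<sigma> x $ i)" for S i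
    using \<sigma>(2) by (intro continuous_intros) (meson continuous_on_subset subset_UNIV)
  have bound: "\<bar>integral (cbox u v) (\<lambda>x. partial_deriv i \<sigma> x $ i)\<bar>
      \<le> 2 * F (axis i 1) * (\<Prod>j\<in>- {i}. v $ j - u $ j)" for i
    unfolding partial_deriv_def
  proof (rule integral_partial_deriv_bound[where f = "\<lambda>x. \<sigma> x $ i"])
    show "((\<lambda>x. \<sigma> x $ i) has_derivative (\<lambda>h. frechet_derivative \<sigma> (at x) h $ i)) (at x)" for x
      using \<sigma>(1)[of x] unfolding frechet_derivative_works
      by (rule bounded_linear.has_derivative[OF bounded_linear_vec_nth])
    show "continuous_on UNIV (\<lambda>x. frechet_derivative \<sigma> (at x) (axis i 1) $ i)"
      using cont unfolding partial_deriv_def .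
    fix x
    have "\<bar>\<sigma> x $ i\<bar> = \<bar>axis i 1 \<bullet> \<sigma> x\<bar>" by (simp add: inner_axis')
    also have "\<dots> \<le> F (axis i 1) * polar_fun F (\<sigma> x)" by (rule abs_inner_le_polar)
    also have "\<dots> \<le> F (axis i 1)" using \<sigma>(3) nonneg by (intro mult_left_le) auto
    finally show "\<bar>\<sigma> x $ i\<bar> \<le> F (axis i 1)" .
  qed (rule uv)
  have cont_div: "continuous_on S (divergence \<sigma>)" for S
    unfolding divergence_def[abs_def] by (intro continuous_on_sum cont)
  have "set_integrable lebesgue (box u v) (divergence \<sigma>)"
    by (rule set_integrable_lebesgue_continuous[OF cont_div]) (auto simp: bounded_box)
  then have "(LINT x:box u v|lebesgue. divergence \<sigma> x) = integral (box u v) (divergence \<sigma>)"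
    by (rule set_lebesgue_integral_eq_integral)
  also have "\<dots> = (\<Sum>i\<in>UNIV. integral (cbox u v) (\<lambda>x. partial_deriv i \<sigma> x $ i))"
    unfolding integral_open_interval divergence_def[abs_def]
    by (intro integral_sum integrable_continuous cont) auto
  also have "\<dots> \<le> (\<Sum>i\<in>UNIV. 2 * F (axis i 1) * (\<Prod>j\<in>- {i}. v $ j - u $ j))"
    by (intro sum_mono order_trans[OF abs_ge_self bound])
  finally show "ereal (LINT x:box u v|lebesgue. divergence \<sigma> x)
      \<le> ereal (\<Sum>i\<in>UNIV. 2 * F (axis i 1) * (\<Prod>j\<in>- {i}. v $ j - u $ j))" by simp
qed

text \<open>The box itself is the competitor; dividing the area of a pair of faces by the volume
  leaves the reciprocal of one side.\<close>

lemma anisotropic_cheeger_box_le: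
  assumes uv: "\<And>i. u $ i < v $ i"
  shows "anisotropic_cheeger F (box u v) \<le> ereal (\<Sum>i\<in>UNIV. 2 * F (axis i 1) / (v $ i - u $ i))"
proof -
  define V where "V = (\<Prod>j\<in>UNIV. v $ j - u $ j)"
  have "0 < V" unfolding V_def using uv by (intro prod_pos) auto
  have "cbox u v \<noteq> {}" using uv by (auto simp: interval_ne_empty_cart less_imp_le)
  then have "measure lborel (cbox u v) = V"
    by (simp add: content_cbox_cart V_def del: measure_lborel_cbox)
  then have "measure lborel (box u v) = V"
    by (simp only: measure_lborel_box_eq measure_lborel_cbox_eq)
  then have "emeasure lborel (box u v) = ennreal V"
    using emeasure_eq_ennreal_measure[of lborel "box u v"] emeasure_lborel_box_finite[of u v]
    by (metis less_irrefl infinity_ennreal_def)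
  then have V: "emeasure lebesgue (box u v) = ennreal V" by simp
  have "anisotropic_cheeger F (box u v) \<le> anisotropic_perimeter F (box u v) / enn2ereal (emeasure lebesgue (box u v))"
    unfolding anisotropic_cheeger_def using \<open>0 < V\<close> V by (intro INF_lower) auto
  also have "\<dots> \<le> ereal (\<Sum>i\<in>UNIV. 2 * F (axis i 1) * (\<Prod>j\<in>- {i}. v $ j - u $ j)) / ereal V"
    unfolding V enn2ereal_ennreal[OF less_imp_le[OF \<open>0 < V\<close>]]
    using \<open>0 < V\<close> by (intro ereal_divide_right_mono anisotropic_perimeter_box_le uv) simp
  also have "\<dots> = ereal (\<Sum>i\<in>UNIV. 2 * F (axis i 1) / (v $ i - u $ i))"
  proof -
    have "2 * F (axis i 1) * (\<Prod>j\<in>- {i}. v $ j - u $ j) / V = 2 * F (axis i 1) / (v $ i - u $ i)" for i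
    proof -
      define P where "P = (\<Prod>j\<in>- {i}. v $ j - u $ j)"
      have "0 < P" unfolding P_def using uv by (intro prod_pos) simp
      moreover have "V = (v $ i - u $ i) * P"
        unfolding V_def P_def by (simp add: prod.remove[of UNIV i] Compl_eq_Diff_UNIV)
      ultimately show ?thesis by (simp flip: P_def)
    qed
    then show ?thesis using \<open>0 < V\<close> by (simp add: sum_divide_distrib)
  qed
  finally show ?thesis .
qed

text \<open>The product is squeezed between 1, from the general inequality, and
  \<open>1 / f * (f + C / (real k + 1))\<close>, where the long sides contribute only the vanishing
  term.\<close>

theorem inradius_cheeger_optimal:
  "\<exists>\<Omega> :: nat \<Rightarrow> (real^'n) set. (\<forall>k. open_rectangle (\<Omega> k)) \<and>
    (\<lambda>k. anisotropic_inradius F (\<Omega> k) * anisotropic_cheeger F (\<Omega> k)) \<longlonglongrightarrow> 1"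
proof -
  define i0 :: 'n where "i0 = undefined"
  \<comment> \<open>These are half-widths; \<open>real k + 1\<close> keeps the box nondegenerate at
    \<open>k = 0\<close>.\<close>
  define w :: "nat \<Rightarrow> real^'n" where "w k = (\<chi> i. if i = i0 then 1 else real k + 1)" for k
  define \<Omega> where "\<Omega> k = box (- w k) (w k)" for k
  define f where "f = F (axis i0 1)"
  define C where "C = (\<Sum>i\<in>- {i0}. F (axis i 1))"
  have "0 < f" unfolding f_def by (rule pos) (simp add: axis_eq_0_iff)
  have w: "(- w k) $ i < w k $ i" for k i by (simp add: w_def)
  have R: "anisotropic_inradius F (\<Omega> k) \<le> ereal (1 / f)" for k
    using anisotropic_inradius_box_le[of "- w k" "w k" i0] by (simp add: \<Omega>_def w_def f_def)
  have h: "anisotropic_cheeger F (\<Omega> k) \<le> ereal (f + C / (real k + 1))" for k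
  proof -
    have "(\<Sum>i\<in>UNIV. 2 * F (axis i 1) / (w k $ i - (- w k) $ i)) = f + C / (real k + 1)"
      unfolding sum.remove[of UNIV i0, simplified] f_def C_def sum_divide_distrib
      by (intro arg_cong2[where f = "(+)"] sum.cong) (auto simp: w_def Compl_eq_Diff_UNIV frac_eq_eq algebra_simps)
    then show ?thesis
      using anisotropic_cheeger_box_le[OF w, of k] by (simp add: \<Omega>_def)
  qed
  have bounds: "1 \<le> anisotropic_inradius F (\<Omega> k) * anisotropic_cheeger F (\<Omega> k)"
    "anisotropic_inradius F (\<Omega> k) * anisotropic_cheeger F (\<Omega> k) \<le> ereal (1 / f * (f + C / (real k + 1)))" for k
  proof -
    have "0 \<in> \<Omega> k" by (simp add: \<Omega>_def mem_box_cart w_def)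
    then have R0: "0 \<le> anisotropic_inradius F (\<Omega> k)" by (intro anisotropic_inradius_nonneg) auto
    have le: "1 / anisotropic_inradius F (\<Omega> k) \<le> anisotropic_cheeger F (\<Omega> k)"
      unfolding \<Omega>_def by (rule inverse_inradius_le_cheeger) auto
    obtain \<rho> where \<rho>: "anisotropic_inradius F (\<Omega> k) = ereal \<rho>" "0 \<le> \<rho>" "\<rho> \<le> 1 / f"
      using R[of k] R0 by (cases "anisotropic_inradius F (\<Omega> k)") auto
    \<comment> \<open>Inradius 0 would force an infinite Cheeger constant, against the finite bound
      \<open>h\<close>; the product is thus one of positive reals.\<close>
    have "\<rho> \<noteq> 0"
      using le h[of k] \<rho>(1) by (auto simp: divide_ereal_def zero_ereal_def[symmetric])
    then have "0 < \<rho>" using \<rho> by simp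
    obtain q where q: "anisotropic_cheeger F (\<Omega> k) = ereal q" "1 / \<rho> \<le> q" "q \<le> f + C / (real k + 1)"
      using le h[of k] \<rho>(1) \<open>0 < \<rho>\<close>
      by (cases "anisotropic_cheeger F (\<Omega> k)") (auto simp: one_ereal_def)
    have "0 < q" using q(2) \<open>0 < \<rho>\<close> by (meson less_le_trans zero_less_divide_1_iff)
    have "1 \<le> \<rho> * q" using q(2) \<open>0 < \<rho>\<close> by (simp add: field_simps)
    then show "1 \<le> anisotropic_inradius F (\<Omega> k) * anisotropic_cheeger F (\<Omega> k)"
      by (simp add: \<rho> q one_ereal_def)
    have "\<rho> * q \<le> 1 / f * (f + C / (real k + 1))"
      using \<rho> q \<open>0 < q\<close> \<open>0 < f\<close> by (intro mult_mono) auto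
    then show "anisotropic_inradius F (\<Omega> k) * anisotropic_cheeger F (\<Omega> k) \<le> ereal (1 / f * (f + C / (real k + 1)))"
      by (simp add: \<rho> q)
  qed
  have "(\<lambda>k. 1 / f * (f + C * inverse (real (Suc k)))) \<longlonglongrightarrow> 1 / f * (f + C * 0)"
    by (intro tendsto_intros LIMSEQ_inverse_real_of_nat)
  then have "(\<lambda>k. ereal (1 / f * (f + C / (real k + 1)))) \<longlonglongrightarrow> 1"
    using \<open>0 < f\<close> by (simp add: one_ereal_def divide_inverse add.commute)
  then have "(\<lambda>k. anisotropic_inradius F (\<Omega> k) * anisotropic_cheeger F (\<Omega> k)) \<longlonglongrightarrow> 1"
    by (rule tendsto_sandwich[OF _ _ tendsto_const, rotated 2]) (intro always_eventually allI bounds)+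
  moreover have "open_rectangle (\<Omega> k)" for k
    unfolding open_rectangle_def \<Omega>_def using w
    by (intro exI[of _ id] exI[of _ "- w k"] exI[of _ "w k"]) (auto simp: orthogonal_transformation_id id_def)
  ultimately show ?thesis by blast
qed

end

theorem proposition3p4:
  fixes F :: "real^'n \<Rightarrow> real" and p \<beta> a :: real
  assumes "CARD('n) \<ge> 2"
    and "1 < p"
    and "\<And>\<xi>. 0 \<le> F \<xi>"
    and "convex_on UNIV F"
    and "\<And>t \<xi>. F (t *\<^sub>R \<xi>) = \<bar>t\<bar> * F \<xi>"
    and "0 < a" and "\<And>\<xi>. a * norm \<xi> \<le> F \<xi>"
    and "0 < \<beta>" and "\<beta> < 1" and "C_hoelder_on 3 \<beta> (- {0}) F"
    and "\<And>\<xi>. \<xi> \<noteq> 0 \<Longrightarrow> positive_definite (hessian (\<lambda>x. F x powr p) \<xi>)"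
  shows "(\<forall>\<Omega>. bounded \<Omega> \<and> open \<Omega> \<and> convex \<Omega> \<longrightarrow>
            1 / anisotropic_inradius F \<Omega> \<le> anisotropic_cheeger F \<Omega>) \<and>
         (\<exists>\<Omega> :: nat \<Rightarrow> (real^'n) set. (\<forall>k. open_rectangle (\<Omega> k)) \<and>
            (\<lambda>k. anisotropic_inradius F (\<Omega> k) * anisotropic_cheeger F (\<Omega> k)) \<longlonglongrightarrow> 1)"
proof -
  interpret anisotropic_norm F a
    by unfold_locales (use assms in auto)
  show ?thesis
    using inverse_inradius_le_cheeger inradius_cheeger_optimal by blast
qed

end
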